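(* Let $n \ge 2$ be an integer, let $x_1, \ldots, x_n$ be distinct positive real numbers, and let $s \in \mathbb{R}$. Then the sum $$\sum_{j=1}^n \frac{1}{x_j^s \prod_{k\neq j}(x_j-x_k)}$$ is zero if and only if $s \in \{0,-1,-2, \ldots, -(n-2)\}$, and otherwise the sign of this sum equals the sign of $(-1)^{n+1}s(s+1)\cdots (s+n-2)$.
   Context: For each $j$, the product $\prod_{k\neq j}(x_j-x_k)$ runs over all $k\in\{1,\ldots,n\}$ with $k\neq j$. The power $x_j^s$ is the usual real power of a positive real number. The product $s(s+1)\cdots(s+n-2)$ has $n-1$ factors, namely $s+i$ for $0\le i\le n-2$ (for $n=2$ it is just $s$). *)

theory Defs
  imports Complex_Main
begin

end

theory Submission
  imports Defs "HOL-Computational_Algebra.Polynomial"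
begin

text \<open>
  The sum is the divided difference of \<open>f t = t powr (-s)\<close> at the nodes \<open>x 1, \<dots>, x n\<close>, that is,
  the coefficient of \<open>t ^ (n - 1)\<close> in the polynomial \<open>p\<close> of degree less than \<open>n\<close> that agrees
  with \<open>f\<close> at all the nodes. The difference \<open>f - p\<close> has \<open>n\<close> zeros, so by repeated use of Rolle's
  theorem its derivative of order \<open>n - 1\<close> has a zero \<open>\<xi> > 0\<close>
  (\<open>higher_derivative_vanishes\<close>). The derivative of \<open>p\<close> of that order is the constant
  \<open>(n - 1)!\<close> times the divided difference, which is therefore the derivative of \<open>f\<close> of order
  \<open>n - 1\<close> at \<open>\<xi>\<close>, divided by \<open>(n - 1)!\<close> (\<open>divided_difference_mean_value\<close>).
  For this \<open>f\<close> that derivative is \<open>(-1) ^ (n - 1) * s * (s + 1) * \<dots> * (s + n - 2)\<close> times the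
  positive number \<open>\<xi> powr (-s - (n - 1))\<close>, so the sum is a positive multiple of
  \<open>(-1) ^ (n + 1) * s * (s + 1) * \<dots> * (s + n - 2)\<close>.
\<close>

text \<open>
  Rolle's theorem gives a zero of the derivative in each gap between consecutive zeros.
  Zeros are added in increasing order; the existing zeros of the derivative lie below the largest
  element of \<open>A\<close>, so the one found between it and the next zero is new.
\<close>

lemma derivative_zeros_between_zeros:
  fixes g g' :: "real \<Rightarrow> real"
  assumes conv: "\<And>a b. a \<in> I \<Longrightarrow> b \<in> I \<Longrightarrow> {a..b} \<subseteq> I"
    and deriv: "\<And>t. t \<in> I \<Longrightarrow> (g has_real_derivative g' t) (at t)"
    and "finite A" "A \<subseteq> I" "\<And>a. a \<in> A \<Longrightarrow> g a = 0"
  shows "\<exists>B. finite B \<and> card B = card A - 1 \<and> B \<subseteq> I \<and>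
           (\<forall>z\<in>B. g' z = 0 \<and> (\<exists>a\<in>A. z < a))"
  using assms(3-5)
proof (induction A rule: finite_linorder_max_induct)
  case empty
  show ?case by (intro exI[of _ "{}"]) auto
next
  case (insert b A)
  show ?case
  proof (cases "A = {}")
    case True
    then show ?thesis by (intro exI[of _ "{}"]) auto
  next
    case False
    obtain B where B: "finite B" "card B = card A - 1" "B \<subseteq> I"
      "\<And>z. z \<in> B \<Longrightarrow> g' z = 0" "\<And>z. z \<in> B \<Longrightarrow> \<exists>a\<in>A. z < a"
      using insert by auto
    define m where "m = Max A"
    have m: "m \<in> A" "\<And>a. a \<in> A \<Longrightarrow> a \<le> m"
      using insert.hyps(1) False by (simp_all add: m_def)
    have "m < b" using m insert.hyps by auto
    have sub: "{m..b} \<subseteq> I" using conv insert.prems(1) m(1) by auto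
    have "\<exists>z. m < z \<and> z < b \<and> (*) (g' z) = (\<lambda>h. 0)"
    proof (rule Rolle_deriv[OF \<open>m < b\<close>])
      show "g m = g b" using insert.prems(2) m(1) by auto
      show "continuous_on {m..b} g"
        using sub deriv by (meson DERIV_isCont continuous_at_imp_continuous_on subsetD)
      show "(g has_derivative (*) (g' t)) (at t)" if "m < t" "t < b" for t
        using deriv[of t] sub that
        by (simp add: has_field_derivative_def subset_iff)
    qed
    then obtain z where z: "m < z" "z < b" "(*) (g' z) = (\<lambda>h. 0)" by blast
    have "g' z = 0" using fun_cong[OF z(3), of 1] by simp
    have "z \<notin> B" using B(5) m(2) z(1) by fastforce
    have "b \<notin> A" using insert.hyps(2) by auto
    have "card A > 0" using False insert.hyps(1) by (simp add: card_gt_0_iff)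
    show ?thesis
    proof (intro exI[of _ "insert z B"] conjI)
      show "card (insert z B) = card (insert b A) - 1"
        using B(1,2) \<open>z \<notin> B\<close> \<open>b \<notin> A\<close> insert.hyps(1) \<open>card A > 0\<close> by simp
      show "insert z B \<subseteq> I" using B(3) sub z by auto
    qed (use B z \<open>g' z = 0\<close> in auto)
  qed
qed

text \<open>
  \<open>G k\<close> stands for the derivative of \<open>G 0\<close> of order \<open>k\<close>. Each differentiation loses one of the
  \<open>m + 1\<close> zeros, so one is left after \<open>m\<close> steps.
\<close>

lemma higher_derivative_vanishes:
  fixes G :: "nat \<Rightarrow> real \<Rightarrow> real"
  assumes conv: "\<And>a b. a \<in> I \<Longrightarrow> b \<in> I \<Longrightarrow> {a..b} \<subseteq> I"
    and deriv: "\<And>k t. t \<in> I \<Longrightarrow> (G k has_real_derivative G (Suc k) t) (at t)"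
    and "finite A" "card A = Suc m" "A \<subseteq> I" "\<And>a. a \<in> A \<Longrightarrow> G 0 a = 0"
  shows "\<exists>\<xi>\<in>I. G m \<xi> = 0"
  using deriv assms(3-6)
proof (induction m arbitrary: G A)
  case 0
  then show ?case by (fastforce simp: card_1_singleton_iff)
next
  case (Suc m)
  obtain B where B: "finite B" "card B = Suc m" "B \<subseteq> I" "\<And>z. z \<in> B \<Longrightarrow> G (Suc 0) z = 0"
    using derivative_zeros_between_zeros[of I "G 0" "G (Suc 0)" A, OF conv] Suc.prems
    by fastforce
  show ?case
    using Suc.IH[of "\<lambda>k. G (Suc k)" B] B Suc.prems(1) by auto
qed

text \<open>
  The divided difference is the top coefficient of the Lagrange interpolation polynomial, because
  the basis polynomial of a node \<open>a\<close> is a monic polynomial of degree \<open>m\<close> divided by its value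
  at \<open>a\<close>, the product of the differences.
\<close>

lemma interpolation_polynomial:
  fixes f :: "real \<Rightarrow> real"
  assumes "finite A" "card A = Suc m"
  obtains p where "\<And>a. a \<in> A \<Longrightarrow> poly p a = f a"
    and "degree p \<le> m"
    and "coeff p m = (\<Sum>a\<in>A. f a / (\<Prod>b\<in>A - {a}. a - b))"
proof -
  define L where "L a = (\<Prod>b\<in>A - {a}. [:- b, 1:])" for a
  define p where "p = (\<Sum>a\<in>A. smult (f a / (\<Prod>b\<in>A - {a}. a - b)) (L a))"
  have deg: "degree (L a) = m" if "a \<in> A" for a
    using assms that by (simp add: L_def degree_prod_eq_sum_degree)
  have lead: "coeff (L a) m = 1" if "a \<in> A" for a
    using lead_coeff_prod[of "\<lambda>b. [:- b, 1:]" "A - {a}"] deg[OF that]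
    by (simp add: L_def)
  have L: "poly (L a) c = (if c = a then (\<Prod>b\<in>A - {a}. a - b) else 0)"
    if "a \<in> A" "c \<in> A" for a c
    using assms(1) that by (auto simp: L_def poly_prod)
  show thesis
  proof (rule that[of p])
    fix c assume "c \<in> A"
    have "poly p c = (\<Sum>a\<in>A. if c = a then f a else 0)"
      unfolding p_def poly_sum
      using assms(1) L \<open>c \<in> A\<close> by (intro sum.cong) auto
    then show "poly p c = f c" using assms(1) \<open>c \<in> A\<close> by simp
  next
    show "degree p \<le> m"
      unfolding p_def using deg assms(1)
      by (intro degree_sum_le) (auto intro: order.trans[OF degree_smult_le])
    show "coeff p m = (\<Sum>a\<in>A. f a / (\<Prod>b\<in>A - {a}. a - b))"
      unfolding p_def using lead by (simp add: coeff_sum)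
  qed
qed

text \<open>
  The proof extends that of the ordinary mean value theorem, which is the case of two nodes:
  subtracting the interpolating polynomial (there, the secant) reduces it to Rolle's theorem.
\<close>

theorem divided_difference_mean_value:
  fixes F :: "nat \<Rightarrow> real \<Rightarrow> real"
  assumes conv: "\<And>a b. a \<in> I \<Longrightarrow> b \<in> I \<Longrightarrow> {a..b} \<subseteq> I"
    and deriv: "\<And>k t. t \<in> I \<Longrightarrow> (F k has_real_derivative F (Suc k) t) (at t)"
    and A: "finite A" "card A = Suc m" "A \<subseteq> I"
  shows "\<exists>\<xi>\<in>I. (\<Sum>a\<in>A. F 0 a / (\<Prod>b\<in>A - {a}. a - b)) = F m \<xi> / fact m"
proof -
  obtain p where p: "\<And>a. a \<in> A \<Longrightarrow> poly p a = F 0 a" "degree p \<le> m"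
    "coeff p m = (\<Sum>a\<in>A. F 0 a / (\<Prod>b\<in>A - {a}. a - b))"
    using interpolation_polynomial[OF A(1,2), of "F 0"] by blast
  have "\<exists>\<xi>\<in>I. F m \<xi> - poly ((pderiv ^^ m) p) \<xi> = 0"
  proof (rule higher_derivative_vanishes[OF conv _ A])
    show "((\<lambda>t. F k t - poly ((pderiv ^^ k) p) t) has_real_derivative
            F (Suc k) t - poly ((pderiv ^^ Suc k) p) t) (at t)" if "t \<in> I" for k t
      using deriv[OF that] poly_DERIV by (auto intro: DERIV_diff)
  qed (use p(1) in auto)
  then obtain \<xi> where \<xi>: "\<xi> \<in> I" "F m \<xi> = poly ((pderiv ^^ m) p) \<xi>" by auto
  have "degree ((pderiv ^^ m) p) = 0" using p(2) by (simp add: degree_higher_pderiv)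
  then have "poly ((pderiv ^^ m) p) \<xi> = coeff ((pderiv ^^ m) p) 0"
    by (auto elim: degree_eq_zeroE)
  also have "\<dots> = fact m * coeff p m"
    by (simp add: coeff_higher_pderiv pochhammer_fact)
  finally show ?thesis using \<xi> p(3) by (intro bexI[of _ \<xi>]) simp_all
qed

lemma DERIV_falling_powr:
  fixes c t :: real
  assumes "t > 0"
  shows "((\<lambda>u. (\<Prod>i<k. c - real i) * u powr (c - real k)) has_real_derivative
           (\<Prod>i<Suc k. c - real i) * t powr (c - real (Suc k))) (at t)"
proof -
  have "((\<lambda>u. u powr (c - real k)) has_real_derivative
      (c - real k) * t powr (c - real k - 1)) (at t)"
    using assms by (rule has_real_derivative_powr)
  then show ?thesis
    by (rule DERIV_cong[OF DERIV_cmult]) (simp add: algebra_simps)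
qed

text \<open>
  The mean value theorem is applied to \<open>t powr (-s)\<close> on the positive half-line. The positive factor
  \<open>C\<close> is \<open>\<xi> powr (-s - (n - 1)) / (n - 1)!\<close>, and the power of \<open>-1\<close> collects the signs of the
  \<open>n - 1\<close> factors \<open>-s - i = -(s + i)\<close>.
\<close>

lemma sum_powr_div_differences:
  fixes s :: real
  assumes "n \<ge> 2"
    and "\<And>j. j \<in> {1..n} \<Longrightarrow> x j > 0"
    and "inj_on x {1..n}"
  shows "\<exists>C>0. (\<Sum>j\<in>{1..n}. 1 / (x j powr s * (\<Prod>k\<in>{1..n} - {j}. x j - x k))) =
           C * ((-1) ^ (n + 1) * (\<Prod>i\<in>{0..n - 2}. s + real i))"
proof -
  define F where "F k t = (\<Prod>i<k. - s - real i) * t powr (- s - real k)" for k t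
  define A where "A = x ` {1..n}"
  have "\<exists>\<xi>\<in>{0<..}. (\<Sum>a\<in>A. F 0 a / (\<Prod>b\<in>A - {a}. a - b)) = F (n - 1) \<xi> / fact (n - 1)"
  proof (rule divided_difference_mean_value)
    show "card A = Suc (n - 1)"
      using assms(1) card_image[OF assms(3)] by (simp add: A_def)
    show "(F k has_real_derivative F (Suc k) t) (at t)" if "t \<in> {0<..}" for k t
      using DERIV_falling_powr[where c = "- s"] that unfolding F_def by simp
  qed (use assms(2) in \<open>auto simp: A_def\<close>)
  then obtain \<xi> where \<xi>: "\<xi> > 0"
    "(\<Sum>a\<in>A. F 0 a / (\<Prod>b\<in>A - {a}. a - b)) = F (n - 1) \<xi> / fact (n - 1)" by auto
  have "(\<Sum>a\<in>A. F 0 a / (\<Prod>b\<in>A - {a}. a - b)) =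
      (\<Sum>j\<in>{1..n}. F 0 (x j) / (\<Prod>b\<in>A - {x j}. x j - b))"
    unfolding A_def by (simp only: sum.reindex[OF assms(3)] o_def)
  also have "\<dots> = (\<Sum>j\<in>{1..n}. 1 / (x j powr s * (\<Prod>k\<in>{1..n} - {j}. x j - x k)))"
  proof (rule sum.cong[OF refl])
    fix j assume j: "j \<in> {1..n}"
    have "A - {x j} = x ` ({1..n} - {j})"
      unfolding A_def using j inj_on_image_set_diff[OF assms(3), of "{1..n}" "{j}"] by auto
    moreover have "inj_on x ({1..n} - {j})" using assms(3) by (rule inj_on_subset) auto
    ultimately have "(\<Prod>b\<in>A - {x j}. x j - b) = (\<Prod>k\<in>{1..n} - {j}. x j - x k)"
      by (simp add: prod.reindex)
    then show "F 0 (x j) / (\<Prod>b\<in>A - {x j}. x j - b) =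
        1 / (x j powr s * (\<Prod>k\<in>{1..n} - {j}. x j - x k))"
      by (simp add: F_def powr_minus_divide)
  qed
  finally have S: "(\<Sum>j\<in>{1..n}. 1 / (x j powr s * (\<Prod>k\<in>{1..n} - {j}. x j - x k))) =
      F (n - 1) \<xi> / fact (n - 1)" using \<xi>(2) by simp
  have range: "{..<n - 1} = {0..n - 2}" using assms(1) by auto
  have sign: "(-1 :: real) ^ (n - 1) = (-1) ^ (n + 1)" using assms(1) by (cases n) auto
  have "(\<Prod>i<n - 1. - s - real i) = (\<Prod>i<n - 1. - 1 * (s + real i))"
    by (intro prod.cong) auto
  also have "\<dots> = (-1) ^ (n - 1) * (\<Prod>i<n - 1. s + real i)"
    by (simp only: prod.distrib) simp
  finally have "F (n - 1) \<xi> / fact (n - 1) = \<xi> powr (- s - real (n - 1)) / fact (n - 1) *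
      ((-1) ^ (n + 1) * (\<Prod>i\<in>{0..n - 2}. s + real i))"
    unfolding F_def range sign by (simp only: times_divide_eq_left mult.commute)
  then show ?thesis using S \<xi>(1)
    by (intro exI[of _ "\<xi> powr (- s - real (n - 1)) / fact (n - 1)"]) simp
qed

theorem theorem1:
  fixes n :: nat and x :: "nat \<Rightarrow> real" and s :: real
  assumes "n \<ge> 2"
    and "\<And>j. j \<in> {1..n} \<Longrightarrow> x j > 0"
    and "inj_on x {1..n}"
  shows "let S = (\<Sum>j\<in>{1..n}. 1 / (x j powr s * (\<Prod>k\<in>{1..n} - {j}. x j - x k)));
             Z = {- real i | i. i \<le> n - 2}
         in (S = 0 \<longleftrightarrow> s \<in> Z) \<and>
            (s \<notin> Z \<longrightarrow> sgn S = sgn ((-1) ^ (n + 1) * (\<Prod>i\<in>{0..n - 2}. s + real i)))"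
proof -
  define S where "S = (\<Sum>j\<in>{1..n}. 1 / (x j powr s * (\<Prod>k\<in>{1..n} - {j}. x j - x k)))"
  obtain C where C: "C > 0" "S = C * ((-1) ^ (n + 1) * (\<Prod>i\<in>{0..n - 2}. s + real i))"
    using sum_powr_div_differences[of n x s, OF assms] unfolding S_def by blast
  have "S = 0 \<longleftrightarrow> (\<exists>i\<in>{0..n - 2}. s + real i = 0)" using C by simp
  also have "\<dots> \<longleftrightarrow> s \<in> {- real i | i. i \<le> n - 2}"
    by (auto simp: add_eq_0_iff2)
  finally have zero: "S = 0 \<longleftrightarrow> s \<in> {- real i | i. i \<le> n - 2}" .
  have "sgn S = sgn ((-1) ^ (n + 1) * (\<Prod>i\<in>{0..n - 2}. s + real i))"
    unfolding C(2) using C(1) by (subst sgn_mult) simp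
  with zero show ?thesis unfolding Let_def S_def by blast
qed

end
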